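(* For any partition $\lambda=(\lambda_1,\dots,\lambda_k)$, $k\ge1$, we have $$Y_{-\lambda_1}Y_{-\lambda_2}\cdots Y_{-\lambda_k}.1=sp_\lambda=\frac12\det\big(h_{\lambda_i-i+j}+h_{\lambda_i-i-j+2}\big)_{1\le i,j\le k}.$$
   Context: $\Lambda=\Lambda_{\mathbb Q}=\mathbb Q[p_1,p_2,\dots]$ is the ring of symmetric functions over $\mathbb Q$ in countably many variables, where $p_n=\sum_i x_i^n$ are the power sums. $h_n$ is the complete homogeneous symmetric function, $\sum_{n\ge0}h_nz^n=\exp(\sum_{n\ge1}\frac{p_n}{n}z^n)$, with $h_0=1$ and $h_n=0$ for $n<0$. The symplectic Schur function $sp_\lambda$ of a partition $\lambda=(\lambda_1\ge\dots\ge\lambda_k\ge0)$, $k\ge1$ (trailing zeros allowed), is by definition $sp_\lambda=\frac12\det(h_{\lambda_i-i+j}+h_{\lambda_i-i-j+2})_{1\le i,j\le k}$. The operators $Y_n$ ($n\in\mathbb Z$) on $\Lambda$ are the coefficients of the vertex operator $$Y(z)=\exp\Big(\sum_{n\ge1}\frac{p_n}{n}z^n\Big)\exp\Big(-\sum_{n\ge1}\frac{\partial}{\partial p_n}(z^{-n}+z^n)\Big)=\sum_{n\in\mathbb Z}Y_nz^{-n}:\ \Lambda\to\Lambda[[z,z^{-1}]],$$ where $p_n$ acts by multiplication (the coefficients are well defined since the exponential of derivatives applied to any given element is a Laurent polynomial in $z$). "$.1$" means applying an operator to $1\in\Lambda$. *)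

theory Defs
  imports
    "HOL-Library.Poly_Mapping"
    "HOL-Computational_Algebra.Formal_Power_Series"
    "Jordan_Normal_Form.Determinant"
begin

(* The ring of symmetric functions over the rationals, as the polynomial ring Q[p_1, p_2, ...]
   in the power sums. An exponent vector e :: nat \<Rightarrow>\<^sub>0 nat stands for the monomial
   prod_i p_(i+1)^(e i): the variable with index i is p_(i+1), so that no variable is left over.
   Everything below that depends on an index n of a power sum is used for n \<ge> 1 only. *)

type_synonym symf = "(nat \<Rightarrow>\<^sub>0 nat) \<Rightarrow>\<^sub>0 rat"

definition cst :: "rat \<Rightarrow> symf" where
  "cst c = Poly_Mapping.single 0 c"

definition psum :: "nat \<Rightarrow> symf" where
  "psum n = Poly_Mapping.single (Poly_Mapping.single (n - 1) 1) 1"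

(* The formal partial derivative with respect to p_n: the truncated difference of exponents
   is only relevant where the exponent of p_n is positive. *)
definition dpsum :: "nat \<Rightarrow> symf \<Rightarrow> symf" where
  "dpsum n f = (\<Sum>e\<in>Poly_Mapping.keys f.
     Poly_Mapping.single (e - Poly_Mapping.single (n - 1) 1)
       (of_nat (Poly_Mapping.lookup e (n - 1)) * Poly_Mapping.lookup f e))"

(* fps_exp is available over fields only, so the exponential series is written out. *)
definition exp_series :: "symf fps" where
  "exp_series = Abs_fps (\<lambda>k. cst (1 / fact k))"

definition H_series :: "symf fps" where
  "H_series = exp_series oo Abs_fps (\<lambda>n. if n = 0 then 0 else cst (1 / of_nat n) * psum n)"

definition h :: "int \<Rightarrow> symf" where
  "h n = (if n < 0 then 0 else fps_nth H_series (nat n))"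

definition is_partition :: "nat list \<Rightarrow> bool" where
  "is_partition lam \<longleftrightarrow> sorted_wrt (\<ge>) lam"

(* Row a and column b of the matrix (counted from 0) are the row i = a + 1 and the column
   j = b + 1 of the usual formula. *)
definition sp_matrix :: "nat list \<Rightarrow> symf mat" where
  "sp_matrix lam = mat (length lam) (length lam) (\<lambda>(a, b).
     let i = int a + 1; j = int b + 1; l = int (lam ! a)
     in h (l - i + j) + h (l - i - j + 2))"

definition sp :: "nat list \<Rightarrow> symf" where
  "sp lam = cst (1 / 2) * det (sp_matrix lam)"

(* Laurent polynomials in z over symf, with the convolution product. *)
type_synonym laurent = "int \<Rightarrow>\<^sub>0 symf"

definition zpow :: "int \<Rightarrow> laurent" where
  "zpow m = Poly_Mapping.single m 1"

definition lconst :: "symf \<Rightarrow> laurent" where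
  "lconst f = Poly_Mapping.single 0 f"

(* The operator - sum_(n \<ge> 1) d/dp_n (z^(-n) + z^n), extended linearly in z to Laurent
   polynomials. Sum_any is the sum over all indices, meaningful for finite support; the support
   is finite by finite_dpsum_support. *)
definition vertex_deriv :: "laurent \<Rightarrow> laurent" where
  "vertex_deriv g = - Sum_any (\<lambda>n. if n = 0 then 0 else
     (zpow (- int n) + zpow (int n)) * Poly_Mapping.map (dpsum n) g)"

(* The exponential of this operator, applied to f; only finitely many terms are nonzero, see
   finite_vertex_exp_support. *)
definition vertex_exp :: "symf \<Rightarrow> laurent" where
  "vertex_exp f = Sum_any (\<lambda>k. lconst (cst (1 / fact k)) * (vertex_deriv ^^ k) (lconst f))"

lemma dpsum_nonzeroD:
  assumes "dpsum n f \<noteq> 0"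
  shows "\<exists>e\<in>Poly_Mapping.keys f. n - 1 \<in> Poly_Mapping.keys e"
proof (rule ccontr)
  assume "\<not> ?thesis"
  then have "dpsum n f = 0"
    unfolding dpsum_def by (intro sum.neutral) (auto simp: in_keys_iff)
  with assms show False by simp
qed

lemma lookup_map_dpsum:
  "Poly_Mapping.lookup (Poly_Mapping.map (dpsum n) g) j = dpsum n (Poly_Mapping.lookup g j)"
  by (cases "Poly_Mapping.lookup g j = 0") (auto simp: Poly_Mapping.map.rep_eq dpsum_def)

lemma finite_dpsum_support:
  "finite {n. (if n = 0 then 0 else
     (zpow (- int n) + zpow (int n)) * Poly_Mapping.map (dpsum n) g) \<noteq> 0}"
proof (rule finite_subset)
  let ?S = "\<Union>j\<in>Poly_Mapping.keys g. \<Union>e\<in>Poly_Mapping.keys (Poly_Mapping.lookup g j).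
    Poly_Mapping.keys e"
  show "finite (Suc ` ?S)" by simp
  show "{n. (if n = 0 then 0 else
     (zpow (- int n) + zpow (int n)) * Poly_Mapping.map (dpsum n) g) \<noteq> 0} \<subseteq> Suc ` ?S"
  proof
    fix n assume "n \<in> {n. (if n = 0 then 0 else
     (zpow (- int n) + zpow (int n)) * Poly_Mapping.map (dpsum n) g) \<noteq> 0}"
    then have n: "n \<noteq> 0" and "Poly_Mapping.map (dpsum n) g \<noteq> 0"
      by (auto split: if_splits)
    then obtain j where j: "j \<in> Poly_Mapping.keys g"
      and nz: "dpsum n (Poly_Mapping.lookup g j) \<noteq> 0"
      by (auto simp: Poly_Mapping.map_eq_zero_iff)
    from dpsum_nonzeroD[OF nz] obtain e
      where "e \<in> Poly_Mapping.keys (Poly_Mapping.lookup g j)" "n - 1 \<in> Poly_Mapping.keys e" by blast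
    with j n show "n \<in> Suc ` ?S"
      by (intro image_eqI[of _ _ "n - 1"]) auto
  qed
qed

definition mdeg :: "(nat \<Rightarrow>\<^sub>0 nat) \<Rightarrow> nat" where
  "mdeg e = (\<Sum>i\<in>Poly_Mapping.keys e. Poly_Mapping.lookup e i)"

definition deg_lt :: "nat \<Rightarrow> symf \<Rightarrow> bool" where
  "deg_lt k f \<longleftrightarrow> (\<forall>e\<in>Poly_Mapping.keys f. mdeg e < k)"

lemma deg_lt_0 [simp]: "deg_lt k 0"
  by (simp add: deg_lt_def)

lemma deg_lt_add: "deg_lt k f \<Longrightarrow> deg_lt k g \<Longrightarrow> deg_lt k (f + g)"
  using Poly_Mapping.keys_add[of f g] unfolding deg_lt_def by blast

lemma deg_lt_uminus: "deg_lt k f \<Longrightarrow> deg_lt k (- f)"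
  by (simp add: deg_lt_def)

lemma deg_lt_sum: "(\<And>x. x \<in> A \<Longrightarrow> deg_lt k (F x)) \<Longrightarrow> deg_lt k (sum F A)"
  by (induction A rule: infinite_finite_induct) (auto intro: deg_lt_add)

lemma mdeg_diff:
  assumes "i \<in> Poly_Mapping.keys e"
  shows "mdeg (e - Poly_Mapping.single i 1) < mdeg e"
proof -
  have "mdeg (e - Poly_Mapping.single i 1)
      = (\<Sum>j\<in>Poly_Mapping.keys e. Poly_Mapping.lookup (e - Poly_Mapping.single i 1) j)"
    unfolding mdeg_def
    by (intro sum.mono_neutral_left) (auto simp: in_keys_iff lookup_minus)
  also have "\<dots> < mdeg e"
    unfolding mdeg_def using assms
    by (intro sum_strict_mono_ex1) (auto simp: in_keys_iff lookup_minus intro!: bexI[of _ i])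
  finally show ?thesis .
qed

lemma deg_lt_dpsum:
  assumes "deg_lt (Suc k) f"
  shows "deg_lt k (dpsum n f)"
  unfolding dpsum_def
proof (rule deg_lt_sum)
  fix e assume "e \<in> Poly_Mapping.keys f"
  with assms have "mdeg e < Suc k" by (auto simp: deg_lt_def)
  then show "deg_lt k (Poly_Mapping.single (e - Poly_Mapping.single (n - 1) 1)
       (of_nat (Poly_Mapping.lookup e (n - 1)) * Poly_Mapping.lookup f e))"
    using mdeg_diff[of "n - 1" e]
    by (cases "n - 1 \<in> Poly_Mapping.keys e") (auto simp: deg_lt_def in_keys_iff split: if_splits)
qed

lemma lookup_zpow_times:
  "Poly_Mapping.lookup (zpow m * g) j = Poly_Mapping.lookup g (j - m)"
proof -
  have "(\<Sum>q. Poly_Mapping.lookup g q when j = m + q)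
      = (\<Sum>q. Poly_Mapping.lookup g (j - m) when q = j - m)"
    by (intro Sum_any.cong) (auto simp: when_def)
  then show ?thesis
    by (simp add: zpow_def lookup_mult lookup_single when_mult)
qed

lemma deg_lt_vertex_deriv:
  assumes "\<And>j. deg_lt (Suc k) (Poly_Mapping.lookup g j)"
  shows "deg_lt k (Poly_Mapping.lookup (vertex_deriv g) j)"
proof -
  have "deg_lt k (Poly_Mapping.lookup (\<Sum>n\<in>N. if n = 0 then 0 else
     (zpow (- int n) + zpow (int n)) * Poly_Mapping.map (dpsum n) g) j)" for N :: "nat set"
    unfolding lookup_sum using assms
    by (intro deg_lt_sum)
       (auto simp: distrib_right lookup_add lookup_zpow_times lookup_map_dpsum
         intro!: deg_lt_add deg_lt_dpsum)
  then show ?thesis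
    by (simp add: vertex_deriv_def Sum_any.expand_set deg_lt_uminus)
qed

lemma finite_vertex_exp_support:
  "finite {k. lconst (cst (1 / fact k)) * (vertex_deriv ^^ k) (lconst f) \<noteq> 0}"
proof -
  define d where "d = Suc (Max (insert 0 (mdeg ` Poly_Mapping.keys f)))"
  have d: "deg_lt d f"
    by (auto simp: deg_lt_def d_def less_Suc_eq_le intro!: Max_ge)
  have "deg_lt (d - k) (Poly_Mapping.lookup ((vertex_deriv ^^ k) (lconst f)) j)" if "k \<le> d" for k j
    using that
  proof (induction k arbitrary: j)
    case 0
    then show ?case using d by (simp add: lconst_def lookup_single when_def)
  next
    case (Suc k)
    then have "d - k = Suc (d - Suc k)" by simp
    with Suc show ?case by (simp add: deg_lt_vertex_deriv)
  qed
  from this[of d] have d0: "(vertex_deriv ^^ d) (lconst f) = 0"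
    by (intro poly_mapping_eqI) (auto simp: deg_lt_def)
  have "(vertex_deriv ^^ (d + i)) (lconst f) = 0" for i
  proof (induction i)
    case (Suc i)
    have "Poly_Mapping.map (dpsum n) (0 :: laurent) = 0" for n
      by (simp add: Poly_Mapping.map_eq_zero_iff)
    then have "vertex_deriv 0 = 0"
      by (simp add: vertex_deriv_def cong: if_cong)
    with Suc show ?case by simp
  qed (simp add: d0)
  then have "(vertex_deriv ^^ k) (lconst f) = 0" if "d \<le> k" for k
    using that by (metis le_Suc_ex)
  then have "{k. lconst (cst (1 / fact k)) * (vertex_deriv ^^ k) (lconst f) \<noteq> 0} \<subseteq> {..<d}"
    by (auto simp: not_le[symmetric])
  then show ?thesis by (rule finite_subset) simp
qed

(* Y(z) f as a formal series, m being mapped to the coefficient of z^m: the product of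
   sum_n h_n z^n with a Laurent polynomial. *)
definition Y_series :: "symf \<Rightarrow> int \<Rightarrow> symf" where
  "Y_series f m = (\<Sum>j\<in>Poly_Mapping.keys (vertex_exp f).
     h (m - j) * Poly_Mapping.lookup (vertex_exp f) j)"

definition Y :: "int \<Rightarrow> symf \<Rightarrow> symf" where
  "Y n f = Y_series f (- n)"

end

theory Submission
  imports Defs
begin

text \<open>The exponential of the derivation is a ring homomorphism from symmetric functions to Laurent
  polynomials that sends \<open>p\<^sub>n\<close> to \<open>p\<^sub>n - z\<^sup>n - z\<^sup>-\<^sup>n\<close>, since
  \<open>D (p\<^sub>n g) = p\<^sub>n D g - t g\<close> with a \<open>D\<close>-constant \<open>t\<close> implies
  \<open>exp D (p\<^sub>n g) = (p\<^sub>n - t) exp D g\<close>. Newton's identities then give \<open>h\<^sub>m \<mapsto> h\<^sub>m - (z + 1/z) h\<^sub>m\<^sub>-\<^sub>1 + h\<^sub>m\<^sub>-\<^sub>2\<close>.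
  In a Jacobi-Trudi determinant this replaces each column by a combination of three neighbouring
  columns of a wider matrix with shifted rows. The same column operations clear, up to its first
  entry, an extra top row with entries \<open>z\<^sup>j + z\<^sup>-\<^sup>j\<close>. So the image of the determinant is the
  determinant of the bordered matrix, and the coefficient of \<open>z\<^sup>l\<close> after multiplication by
  \<open>\<Sum>n. h\<^sub>n z\<^sup>n\<close> turns the top row into that of the partition with the part \<open>l\<close> put in front.\<close>

subsection \<open>Derivations on Laurent polynomials\<close>

lemma poly_mapping_eq_sum_single:
  fixes f :: "'a \<Rightarrow>\<^sub>0 'b :: comm_monoid_add"
  shows "f = (\<Sum>k\<in>Poly_Mapping.keys f. Poly_Mapping.single k (Poly_Mapping.lookup f k))"
  by (rule poly_mapping_eqI)
    (auto simp: lookup_sum lookup_single when_def in_keys_iff sum.delta)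

lemma poly_mapping_add_induct [case_names zero single add]:
  fixes f :: "'a \<Rightarrow>\<^sub>0 'b :: comm_monoid_add"
  assumes "P 0"
    and "\<And>k c. P (Poly_Mapping.single k c)"
    and "\<And>f g. P f \<Longrightarrow> P g \<Longrightarrow> P (f + g)"
  shows "P f"
proof -
  have "P (\<Sum>k\<in>A. Poly_Mapping.single k (Poly_Mapping.lookup f k))" for A
    by (induction A rule: infinite_finite_induct) (auto intro: assms)
  from this[of "Poly_Mapping.keys f"] show ?thesis
    by (simp flip: poly_mapping_eq_sum_single)
qed

text \<open>A monomial loses degree when one of its variables is split off, so every monomial is
  reached from a constant by factors \<open>psum\<close>. Using \<open>Suc i\<close> names each
  generator once, since \<open>psum 0\<close> is \<open>psum 1\<close>.\<close>

lemma symf_induct [case_names const psum add]: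
  assumes const: "\<And>c. P (cst c)"
    and psum: "\<And>i f. P f \<Longrightarrow> P (psum (Suc i) * f)"
    and add: "\<And>f g. P f \<Longrightarrow> P g \<Longrightarrow> P (f + g)"
  shows "P f"
proof (induction f rule: poly_mapping_add_induct)
  case zero
  then show ?case using const[of 0] by (simp add: cst_def)
next
  case (single e c)
  show ?case
  proof (induction e rule: measure_induct_rule[of mdeg])
    case (less e)
    show ?case
    proof (cases "e = 0")
      case True
      then show ?thesis using const[of c] by (simp add: cst_def)
    next
      case False
      then obtain i where i: "i \<in> Poly_Mapping.keys e"
        by (metis equals0I keys_eq_empty)
      have "e = Poly_Mapping.single i 1 + (e - Poly_Mapping.single i 1)"
        using i by (intro poly_mapping_eqI)
          (auto simp: lookup_add lookup_minus lookup_single when_def in_keys_iff)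
      then have "Poly_Mapping.single e c
          = psum (Suc i) * Poly_Mapping.single (e - Poly_Mapping.single i 1) c"
        by (simp add: psum_def mult_single)
      then show ?thesis
        using psum less[OF mdeg_diff[OF i]] by simp
    qed
  qed
qed (rule add)

lemma comm_ring_hom_single_zero:
  "comm_ring_hom (Poly_Mapping.single (0::'a::comm_monoid_add) :: 'b::comm_ring_1 \<Rightarrow> _)"
  by unfold_locales (simp_all add: single_add mult_single)

interpretation cst: comm_ring_hom cst
  unfolding cst_def by (rule comm_ring_hom_single_zero)

interpretation lconst: comm_ring_hom lconst
  unfolding lconst_def by (rule comm_ring_hom_single_zero)

section \<open>Partial derivatives in the power sums\<close>

lemma dpsum_superset:
  assumes "finite A" "Poly_Mapping.keys f \<subseteq> A"
  shows "dpsum n f = (\<Sum>e\<in>A. Poly_Mapping.single (e - Poly_Mapping.single (n - 1) 1)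
    (of_nat (Poly_Mapping.lookup e (n - 1)) * Poly_Mapping.lookup f e))"
  unfolding dpsum_def using assms
  by (intro sum.mono_neutral_left) (auto simp: in_keys_iff)

lemma dpsum_add: "dpsum n (f + g) = dpsum n f + dpsum n g"
proof -
  let ?A = "Poly_Mapping.keys f \<union> Poly_Mapping.keys g"
  have "Poly_Mapping.keys (f + g) \<subseteq> ?A" by (rule Poly_Mapping.keys_add)
  then show ?thesis
    by (simp add: dpsum_superset[of ?A] lookup_add distrib_left single_add sum.distrib)
qed

lemma dpsum_zero [simp]: "dpsum n 0 = 0"
  by (simp add: dpsum_def)

lemma dpsum_single:
  "dpsum n (Poly_Mapping.single e c) = Poly_Mapping.single (e - Poly_Mapping.single (n - 1) 1)
    (of_nat (Poly_Mapping.lookup e (n - 1)) * c)"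
  by (subst dpsum_superset[of "{e}"]) auto

lemma dpsum_cst [simp]: "dpsum n (cst c) = 0"
  by (simp add: cst_def dpsum_single)

lemma dpsum_psum:
  assumes "m > 0" "n > 0"
  shows "dpsum m (psum n) = (if m = n then 1 else 0)"
  using assms by (auto simp: psum_def dpsum_single lookup_single when_def)

lemma dpsum_mult: "dpsum n (f * g) = dpsum n f * g + f * dpsum n g"
proof (induction f rule: poly_mapping_add_induct)
  case (single a c)
  show ?case
  proof (induction g rule: poly_mapping_add_induct)
    case (single b d)
    let ?u = "Poly_Mapping.single (n - 1) (1 :: nat)"
    \<comment> \<open>Truncated subtraction may be moved to a summand only if the variable occurs in
      it; if not, the exponent 0 as coefficient kills the term.\<close>
    have "a + b - ?u = a - ?u + b" if "Poly_Mapping.lookup a (n - 1) > 0"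
      using that by (intro poly_mapping_eqI)
        (auto simp: lookup_add lookup_minus lookup_single when_def)
    moreover have "a + b - ?u = a + (b - ?u)" if "Poly_Mapping.lookup b (n - 1) > 0"
      using that by (intro poly_mapping_eqI)
        (auto simp: lookup_add lookup_minus lookup_single when_def)
    ultimately show ?case
      by (cases "Poly_Mapping.lookup a (n - 1) = 0"; cases "Poly_Mapping.lookup b (n - 1) = 0")
        (simp_all add: mult_single dpsum_single lookup_add algebra_simps flip: single_add)
  qed (simp_all add: dpsum_add algebra_simps)
qed (simp_all add: dpsum_add algebra_simps)

section \<open>Coefficientwise derivatives of Laurent polynomials\<close>

lemma map_dpsum_add:
  "Poly_Mapping.map (dpsum n) (f + g) = Poly_Mapping.map (dpsum n) f + Poly_Mapping.map (dpsum n) g"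
  by (rule poly_mapping_eqI) (simp add: lookup_map_dpsum lookup_add dpsum_add)

lemma map_dpsum_zero [simp]: "Poly_Mapping.map (dpsum n) 0 = 0"
  by (rule poly_mapping_eqI) (simp add: lookup_map_dpsum)

lemma lookup_lconst_times:
  "Poly_Mapping.lookup (lconst f * g) j = f * Poly_Mapping.lookup g j"
proof (induction g rule: poly_mapping_add_induct)
  case (single k c)
  then show ?case by (simp add: lconst_def mult_single lookup_single when_def)
qed (simp_all add: distrib_left lookup_add)

lemma map_dpsum_lconst: "Poly_Mapping.map (dpsum n) (lconst f) = lconst (dpsum n f)"
  by (rule poly_mapping_eqI) (auto simp: lookup_map_dpsum lconst_def lookup_single when_def)

lemma map_dpsum_lconst_times:
  "Poly_Mapping.map (dpsum n) (lconst f * g) =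
    lconst (dpsum n f) * g + lconst f * Poly_Mapping.map (dpsum n) g"
  by (rule poly_mapping_eqI)
    (simp add: lookup_map_dpsum lookup_lconst_times lookup_add dpsum_mult)

lemma map_dpsum_zpow_times:
  "Poly_Mapping.map (dpsum n) (zpow m * g) = zpow m * Poly_Mapping.map (dpsum n) g"
  by (rule poly_mapping_eqI) (simp add: lookup_map_dpsum lookup_zpow_times)

text \<open>With x = z + 1/z this is 2 T_m(x/2), T_m being the Chebyshev polynomial of the first
  kind; the value at 0 is 2.\<close>

definition zsym :: "int \<Rightarrow> laurent" where
  "zsym m = zpow (- m) + zpow m"

lemma vertex_deriv_zsym:
  "vertex_deriv g = - Sum_any (\<lambda>n. if n = 0 then 0 else
     zsym (int n) * Poly_Mapping.map (dpsum n) g)"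
  unfolding vertex_deriv_def zsym_def ..

lemma finite_zsym_dpsum_support:
  "finite {n. (if n = 0 then 0 else zsym (int n) * Poly_Mapping.map (dpsum n) g) \<noteq> 0}"
  unfolding zsym_def by (rule finite_dpsum_support)

lemma vertex_deriv_add: "vertex_deriv (f + g) = vertex_deriv f + vertex_deriv g"
proof -
  have "Sum_any (\<lambda>n. if n = 0 then 0 else zsym (int n) * Poly_Mapping.map (dpsum n) (f + g))
    = Sum_any (\<lambda>n. (if n = 0 then 0 else zsym (int n) * Poly_Mapping.map (dpsum n) f)
      + (if n = 0 then 0 else zsym (int n) * Poly_Mapping.map (dpsum n) g))"
    by (intro Sum_any.cong) (simp add: map_dpsum_add distrib_left)
  then show ?thesis
    by (simp only: vertex_deriv_zsym Sum_any.distrib finite_zsym_dpsum_support minus_add_distrib)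
qed

lemma vertex_deriv_zero [simp]: "vertex_deriv 0 = 0"
  by (simp add: vertex_deriv_zsym cong: if_cong)

lemma vertex_deriv_mult_commute:
  assumes "\<And>n. n > 0 \<Longrightarrow> Poly_Mapping.map (dpsum n) (r * g) = r * Poly_Mapping.map (dpsum n) g"
  shows "vertex_deriv (r * g) = r * vertex_deriv g"
proof -
  have "Sum_any (\<lambda>n. if n = 0 then 0 else zsym (int n) * Poly_Mapping.map (dpsum n) (r * g))
    = Sum_any (\<lambda>n. r * (if n = 0 then 0 else zsym (int n) * Poly_Mapping.map (dpsum n) g))"
    by (intro Sum_any.cong) (simp add: assms mult.left_commute)
  also have "\<dots> = r * Sum_any (\<lambda>n. if n = 0 then 0 else zsym (int n) * Poly_Mapping.map (dpsum n) g)"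
    by (rule Sum_any_right_distrib[OF finite_zsym_dpsum_support, symmetric])
  finally show ?thesis by (simp add: vertex_deriv_zsym)
qed

lemma vertex_deriv_zpow_times: "vertex_deriv (zpow m * g) = zpow m * vertex_deriv g"
  by (rule vertex_deriv_mult_commute) (rule map_dpsum_zpow_times)

lemma vertex_deriv_zsym_times: "vertex_deriv (zsym m * g) = zsym m * vertex_deriv g"
  by (simp add: zsym_def distrib_right vertex_deriv_add vertex_deriv_zpow_times)

lemma vertex_deriv_cst_times:
  "vertex_deriv (lconst (cst c) * g) = lconst (cst c) * vertex_deriv g"
  by (rule vertex_deriv_mult_commute) (simp add: map_dpsum_lconst_times)

text \<open>In the Leibniz rule only the index n = i differentiates \<open>psum i\<close>, which
  gives a single correction term.\<close>

lemma vertex_deriv_psum_times: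
  assumes "i > 0"
  shows "vertex_deriv (lconst (psum i) * g) = lconst (psum i) * vertex_deriv g - zsym (int i) * g"
proof -
  let ?F = "\<lambda>n. if n = 0 then 0 else zsym (int n) * Poly_Mapping.map (dpsum n) g"
  let ?G = "\<lambda>n. if n = 0 then 0 else zsym (int n) * Poly_Mapping.map (dpsum n) (lconst (psum i) * g)"
  have fin: "finite {n. lconst (psum i) * ?F n \<noteq> 0}"
    by (rule finite_subset[OF _ finite_zsym_dpsum_support[of g]]) auto
  have "Sum_any ?G = Sum_any (\<lambda>n. lconst (psum i) * ?F n + (if n = i then zsym (int n) * g else 0))"
    using assms by (intro Sum_any.cong)
      (auto simp: map_dpsum_lconst_times dpsum_psum distrib_left mult.left_commute add.commute)
  also have "\<dots> = lconst (psum i) * Sum_any ?F + zsym (int i) * g"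
    by (subst Sum_any.distrib[OF fin])
      (simp_all only: Sum_any.delta Sum_any_right_distrib[OF finite_zsym_dpsum_support], auto)
  finally show ?thesis by (simp add: vertex_deriv_zsym)
qed

subsection \<open>The vertex exponential as a ring homomorphism\<close>

abbreviation vterm :: "nat \<Rightarrow> symf \<Rightarrow> laurent" where
  "vterm k f \<equiv> lconst (cst (1 / fact k)) * (vertex_deriv ^^ k) (lconst f)"

lemma vterm_bound: "\<exists>N. \<forall>k\<ge>N. vterm k f = 0"
proof -
  obtain N where "\<forall>k\<in>{k. vterm k f \<noteq> 0}. k < N"
    using finite_vertex_exp_support[of f] finite_nat_set_iff_bounded by auto
  then show ?thesis by (metis (mono_tags, lifting) mem_Collect_eq not_le)
qed

lemma vertex_exp_eq_sum:
  assumes "\<forall>k\<ge>N. vterm k f = 0"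
  shows "vertex_exp f = (\<Sum>k<N. vterm k f)"
  unfolding vertex_exp_def using assms
  by (intro Sum_any.expand_superset) (auto simp: not_le[symmetric])

lemma vertex_exp_add: "vertex_exp (f + g) = vertex_exp f + vertex_exp g"
proof -
  have "(vertex_deriv ^^ k) (u + v) = (vertex_deriv ^^ k) u + (vertex_deriv ^^ k) v" for k u v
    by (induction k) (simp_all add: vertex_deriv_add)
  then show ?thesis
    by (simp add: vertex_exp_def lconst.hom_add distrib_left
      Sum_any.distrib[OF finite_vertex_exp_support finite_vertex_exp_support])
qed

lemma vertex_exp_cst_times: "vertex_exp (cst c * f) = lconst (cst c) * vertex_exp f"
proof -
  have "(vertex_deriv ^^ k) (lconst (cst c) * u) = lconst (cst c) * (vertex_deriv ^^ k) u" for k u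
    by (induction k) (simp_all add: vertex_deriv_cst_times)
  then show ?thesis
    by (simp add: vertex_exp_def lconst.hom_mult mult.left_commute
      Sum_any_right_distrib[OF finite_vertex_exp_support])
qed

lemma vertex_deriv_1 [simp]: "vertex_deriv 1 = 0"
proof -
  have "Poly_Mapping.map (dpsum n) (1 :: laurent) = 0" for n
    using map_dpsum_lconst[of n 1] dpsum_cst[of n 1] by simp
  then show ?thesis by (simp add: vertex_deriv_zsym cong: if_cong)
qed

lemma vertex_exp_1 [simp]: "vertex_exp 1 = 1"
proof -
  have "(vertex_deriv ^^ Suc k) 1 = 0" for k
    by (induction k) simp_all
  then have "vterm k 1 = 0" if "k \<ge> 1" for k
    using that by (cases k) auto
  then show ?thesis by (simp add: vertex_exp_eq_sum[of 1])
qed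

lemma vertex_deriv_of_nat_times: "vertex_deriv (of_nat k * g) = of_nat k * vertex_deriv g"
  using vertex_deriv_cst_times[of "of_nat k" g] by (simp add: cst.hom_of_nat lconst.hom_of_nat)

text \<open>The commutator of \<open>vertex_deriv\<close> with \<open>psum i\<close> is
  multiplication by \<open>- zsym i\<close>, which commutes with \<open>vertex_deriv\<close>; each
  further power contributes one more copy.\<close>

lemma vertex_deriv_pow_psum_times:
  assumes "i > 0"
  shows "(vertex_deriv ^^ Suc k) (lconst (psum i) * g) =
    lconst (psum i) * (vertex_deriv ^^ Suc k) g
    - of_nat (Suc k) * (zsym (int i) * (vertex_deriv ^^ k) g)"
proof (induction k)
  case 0
  then show ?case using assms by (simp add: vertex_deriv_psum_times)
next
  case (Suc k)
  have minus: "vertex_deriv (u - v) = vertex_deriv u - vertex_deriv v" for u v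
    using vertex_deriv_add[of "u - v" v] by simp
  have "(vertex_deriv ^^ Suc (Suc k)) (lconst (psum i) * g)
    = vertex_deriv (lconst (psum i) * (vertex_deriv ^^ Suc k) g)
      - of_nat (Suc k) * (zsym (int i) * (vertex_deriv ^^ Suc k) g)"
    by (subst funpow.simps, subst comp_apply, subst Suc)
      (simp only: minus vertex_deriv_of_nat_times vertex_deriv_zsym_times funpow.simps comp_apply)
  then show ?case
    by (simp add: vertex_deriv_psum_times assms algebra_simps)
qed

lemma vertex_exp_psum_times:
  assumes "i > 0"
  shows "vertex_exp (psum i * f) = (lconst (psum i) - zsym (int i)) * vertex_exp f"
proof -
  let ?p = "lconst (psum i)" and ?c = "\<lambda>k. lconst (cst (1 / fact k))"
  obtain N1 N2 where N1: "\<forall>k\<ge>N1. vterm k (psum i * f) = 0" and N2: "\<forall>k\<ge>N2. vterm k f = 0"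
    using vterm_bound by metis
  define N where "N = max N1 N2"
  \<comment> \<open>The multiplicity in the commutator turns 1/(k+1)! into 1/k!, so the correction
    terms form the exponential series again.\<close>
  have c: "?c (Suc k) * of_nat (Suc k) = ?c k" for k
  proof -
    have "?c (Suc k) * of_nat (Suc k) = lconst (cst (1 / fact (Suc k) * of_nat (Suc k)))"
      by (simp only: cst.hom_mult lconst.hom_mult cst.hom_of_nat lconst.hom_of_nat)
    moreover have "1 / fact (Suc k) * of_nat (Suc k) = (1 / fact k :: rat)"
      by (simp add: fact_Suc del: of_nat_Suc)
    ultimately show ?thesis by metis
  qed
  have step: "vterm (Suc k) (psum i * f) = ?p * vterm (Suc k) f - zsym (int i) * vterm k f" for k
    unfolding lconst.hom_mult[of "psum i"] vertex_deriv_pow_psum_times[OF assms]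
    by (subst c[symmetric]) (simp only: right_diff_distrib mult_ac)
  have "vertex_exp (psum i * f) = (\<Sum>k<Suc N. vterm k (psum i * f))"
    by (rule vertex_exp_eq_sum) (use N1 in \<open>simp add: N_def\<close>)
  \<comment> \<open>The commutator formula covers positive powers only; the zeroth term is split off
    and rejoined below.\<close>
  also have "\<dots> = vterm 0 (psum i * f) + (\<Sum>k<N. vterm (Suc k) (psum i * f))"
    by (rule sum.lessThan_Suc_shift)
  also have "\<dots> = ?p * vterm 0 f + ?p * (\<Sum>k<N. vterm (Suc k) f) - zsym (int i) * (\<Sum>k<N. vterm k f)"
    unfolding step by (simp add: sum_subtractf sum_distrib_left lconst.hom_mult mult.left_commute)
  also have "?p * vterm 0 f + ?p * (\<Sum>k<N. vterm (Suc k) f) = ?p * (\<Sum>k<Suc N. vterm k f)"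
    unfolding sum.lessThan_Suc_shift by (rule distrib_left[symmetric])
  also have "(\<Sum>k<Suc N. vterm k f) = vertex_exp f"
    by (rule vertex_exp_eq_sum[symmetric]) (use N2 in \<open>simp add: N_def\<close>)
  also have "(\<Sum>k<N. vterm k f) = vertex_exp f"
    by (rule vertex_exp_eq_sum[symmetric]) (use N2 in \<open>simp add: N_def\<close>)
  finally show ?thesis by (simp add: left_diff_distrib)
qed

lemma vertex_exp_zero [simp]: "vertex_exp 0 = 0"
  using vertex_exp_add[of 0 0] by simp

text \<open>Both sides are additive in f and change by the same factor when f is multiplied by a
  generator.\<close>

lemma vertex_exp_mult: "vertex_exp (f * g) = vertex_exp f * vertex_exp g"
proof (induction f rule: symf_induct)
  case (const c)
  show ?case
    using vertex_exp_cst_times[of c 1] by (simp add: vertex_exp_cst_times)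
next
  case (psum i f)
  then show ?case
    by (simp add: mult.assoc vertex_exp_psum_times)
next
  case (add f1 f2)
  then show ?case by (simp add: distrib_right vertex_exp_add)
qed

interpretation vertex_exp: comm_ring_hom vertex_exp
  by unfold_locales (simp_all add: vertex_exp_add vertex_exp_mult)

lemma vertex_exp_psum: "i > 0 \<Longrightarrow> vertex_exp (psum i) = lconst (psum i) - zsym (int i)"
  using vertex_exp_psum_times[of i 1] by simp

subsection \<open>The image of the complete symmetric functions\<close>

lemma zpow_mult: "zpow a * zpow b = zpow (a + b)"
  by (simp add: zpow_def mult_single)

lemma zsym_0: "zsym 0 = 2"
  by (simp add: zsym_def zpow_def)

lemma zsym_mult: "zsym a * zsym b = zsym (a + b) + zsym (a - b)"
  by (simp add: zsym_def distrib_left distrib_right zpow_mult algebra_simps)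

text \<open>The equation gives n+1 times the coefficient n+1 in terms of earlier ones, and n+1 can
  be cancelled.\<close>

lemma fps_ode_unique:
  fixes f g q :: "'a :: {idom, ring_char_0} fps"
  assumes "fps_deriv f = q * f" "fps_deriv g = q * g" "fps_nth f 0 = fps_nth g 0"
  shows "f = g"
proof (rule fps_ext)
  fix n
  show "fps_nth f n = fps_nth g n"
  proof (induction n rule: less_induct)
    case (less n)
    show ?case
    proof (cases n)
      case (Suc m)
      have "fps_nth (q * f) m = fps_nth (q * g) m"
        unfolding fps_mult_nth using less Suc by (intro sum.cong) auto
      then have "fps_nth (fps_deriv f) m = fps_nth (fps_deriv g) m"
        using assms by simp
      then show ?thesis using Suc
        by (simp del: of_nat_Suc of_nat_add)
    qed (use assms in simp)
  qed
qed

text \<open>The chain rule for the exponential; comparing coefficients yields Newton's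
  identities.\<close>

lemma fps_deriv_H_series: "fps_deriv H_series = Abs_fps (\<lambda>n. psum (Suc n)) * H_series"
proof -
  have "fps_deriv exp_series = exp_series"
  proof (rule fps_ext)
    fix n
    have "fps_nth (fps_deriv exp_series) n = cst (of_nat (Suc n) * (1 / fact (Suc n)))"
      by (simp only: exp_series_def fps_deriv_nth fps_nth_Abs_fps cst.hom_mult cst.hom_of_nat
        Suc_eq_plus1)
    moreover have "of_nat (Suc n) * (1 / fact (Suc n)) = (1 / fact n :: rat)"
      by (simp add: fact_Suc del: of_nat_Suc)
    ultimately show "fps_nth (fps_deriv exp_series) n = fps_nth exp_series n"
      by (simp add: exp_series_def)
  qed
  moreover have "fps_deriv (Abs_fps (\<lambda>n. if n = 0 then 0 else cst (1 / of_nat n) * psum n))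
      = Abs_fps (\<lambda>n. psum (Suc n))"
  proof (rule fps_ext)
    fix n
    have "of_nat (Suc n) * (cst (1 / of_nat (Suc n)) * psum (Suc n))
        = cst (of_nat (Suc n) * (1 / of_nat (Suc n))) * psum (Suc n)"
      by (simp only: cst.hom_mult cst.hom_of_nat mult.assoc)
    then show "fps_nth (fps_deriv (Abs_fps (\<lambda>n. if n = 0 then 0 else cst (1 / of_nat n) * psum n))) n
        = fps_nth (Abs_fps (\<lambda>n. psum (Suc n))) n"
      by (simp del: of_nat_Suc of_nat_add)
  qed
  ultimately show ?thesis
    unfolding H_series_def by (subst fps_compose_deriv) (simp_all add: mult.commute)
qed

lemma H_series_0: "fps_nth H_series 0 = 1"
  by (simp add: H_series_def exp_series_def)

text \<open>The quadratic A(t) is (1 - zt)(1 - t/z), whose negative logarithmic derivative is the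
  series of \<open>zsym\<close>. The right side is -A'(t).\<close>

lemma zsym_series:
  "(1 - fps_const (zsym 1) * fps_X + fps_X * fps_X) * Abs_fps (\<lambda>n. zsym (int (Suc n)))
    = fps_const (zsym 1) - 2 * fps_X"
proof -
  have *: "(fps_const c - 2 * fps_X) = Abs_fps (\<lambda>n. if n = 0 then c else if n = 1 then -2 else 0)"
    for c :: laurent
    by (rule fps_ext) (auto simp: fps_X_def numeral_fps_const)
  show ?thesis
    unfolding *
  proof (rule fps_ext)
    fix n
    consider "n = 0" | "n = 1" | m where "n = Suc (Suc m)"
      by (metis One_nat_def not0_implies_Suc)
    then show "fps_nth ((1 - fps_const (zsym 1) * fps_X + fps_X * fps_X) *
        Abs_fps (\<lambda>n. zsym (int (Suc n)))) n
      = fps_nth (Abs_fps (\<lambda>n. if n = 0 then zsym 1 else if n = 1 then -2 else 0)) n"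
    proof cases
      case 2
      then show ?thesis
        using zsym_mult[of 1 1] by (simp add: algebra_simps zsym_0)
    next
      case 3
      then show ?thesis
        using zsym_mult[of "int m + 2" 1] by (simp add: algebra_simps)
    qed simp
  qed
qed

text \<open>Both sides solve F' = (P - T) F with constant term 1: the left by Newton's identities
  under \<open>vertex_exp\<close>, the right by the product rule and
  \<open>zsym_series\<close>.\<close>

lemma vertex_exp_H_series:
  "Abs_fps (\<lambda>n. vertex_exp (fps_nth H_series n))
    = (1 - fps_const (zsym 1) * fps_X + fps_X * fps_X) * Abs_fps (\<lambda>n. lconst (fps_nth H_series n))"
    (is "?E = ?A * ?L")
proof (rule fps_ode_unique)
  let ?P = "Abs_fps (\<lambda>n. lconst (psum (Suc n)))" and ?T = "Abs_fps (\<lambda>n. zsym (int (Suc n)))"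
  have newton: "of_nat (Suc n) * fps_nth H_series (Suc n)
      = (\<Sum>i=0..n. psum (Suc i) * fps_nth H_series (n - i))" for n
    using arg_cong[OF fps_deriv_H_series, of "\<lambda>F. fps_nth F n"] by (simp add: fps_mult_nth)
  have hom: "fps_deriv (Abs_fps (\<lambda>n. \<phi> (fps_nth H_series n)))
      = Abs_fps (\<lambda>n. \<phi> (psum (Suc n))) * Abs_fps (\<lambda>n. \<phi> (fps_nth H_series n))"
    if "comm_ring_hom \<phi>" for \<phi> :: "symf \<Rightarrow> laurent"
  proof (rule fps_ext)
    interpret comm_ring_hom \<phi> by fact
    fix n
    show "fps_nth (fps_deriv (Abs_fps (\<lambda>n. \<phi> (fps_nth H_series n)))) n
      = fps_nth (Abs_fps (\<lambda>n. \<phi> (psum (Suc n))) * Abs_fps (\<lambda>n. \<phi> (fps_nth H_series n))) n"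
      using arg_cong[OF newton[of n], of \<phi>]
      by (simp add: fps_mult_nth hom_mult hom_sum hom_of_nat del: of_nat_Suc)
  qed
  have "Abs_fps (\<lambda>n. vertex_exp (psum (Suc n))) = ?P - ?T"
    by (rule fps_ext) (simp add: vertex_exp_psum del: of_nat_Suc)
  with hom[OF vertex_exp.comm_ring_hom_axioms]
  show "fps_deriv ?E = (?P - ?T) * ?E" by simp
  have "fps_deriv (?A * ?L) = (2 * fps_X - fps_const (zsym 1)) * ?L + ?A * (?P * ?L)"
    by (simp add: hom[OF lconst.comm_ring_hom_axioms] algebra_simps)
  also have "\<dots> = ?P * (?A * ?L) - ?A * ?T * ?L"
    unfolding zsym_series by (simp add: algebra_simps)
  also have "\<dots> = (?P - ?T) * (?A * ?L)"
    by (simp add: algebra_simps)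
  finally show "fps_deriv (?A * ?L) = (?P - ?T) * (?A * ?L)" .
qed (simp add: H_series_0)

lemma vertex_exp_h:
  "vertex_exp (h m) = lconst (h m) - zsym 1 * lconst (h (m - 1)) + lconst (h (m - 2))"
proof -
  \<comment> \<open>The formula looks back two places, so below m = 2 some terms vanish by the
    convention for negative indices.\<close>
  consider "m < 0" | "m = 0" | "m = 1" | k where "m = int (Suc (Suc k))"
    by (cases m rule: int_cases2; metis One_nat_def int_cases not0_implies_Suc of_nat_0 of_nat_1
      nat_int zero_less_imp_eq_int linorder_neqE_linordered_idom)
  then show ?thesis
  proof cases
    case 4
    then show ?thesis
      using arg_cong[OF vertex_exp_H_series, of "\<lambda>F. fps_nth F (Suc (Suc k))"]
      by (simp add: h_def algebra_simps nat_add_distrib)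
  qed (use arg_cong[OF vertex_exp_H_series, of "\<lambda>F. fps_nth F 0"]
    arg_cong[OF vertex_exp_H_series, of "\<lambda>F. fps_nth F 1"] in \<open>simp_all add: h_def algebra_simps\<close>)
qed

subsection \<open>Determinants\<close>

text \<open>Matrix entry in column j for a row with part minus row index equal to a, both counted
  from 0. Integer j admits a column -1, equal to column 1.\<close>

definition hsym :: "int \<Rightarrow> int \<Rightarrow> symf" where
  "hsym j a = h (a + j) + h (a - j)"

text \<open>The indices a+j, a-j, a+j-2, a-j-2 of the outer terms regroup symmetrically about a-1
  into the columns j+1 and j-1.\<close>

lemma vertex_exp_hsym:
  "vertex_exp (hsym j a) =
    lconst (hsym (j + 1) (a - 1)) - zsym 1 * lconst (hsym j (a - 1)) + lconst (hsym (j - 1) (a - 1))"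
  by (simp add: hsym_def vertex_exp.hom_add vertex_exp_h lconst.hom_add algebra_simps)

lemma hsym_uminus: "hsym (- j) a = hsym j a"
  by (simp add: hsym_def add.commute)

lemma sp_matrix_eq:
  "sp_matrix lam = mat (length lam) (length lam) (\<lambda>(a, b). hsym (int b) (int (lam ! a) - int a))"
  by (rule eq_matI) (auto simp: sp_matrix_def hsym_def Let_def algebra_simps)

text \<open>The coefficient of \<open>z\<^sup>m\<close> in \<open>(\<Sum>n. h n z\<^sup>n) g\<close>.\<close>

definition zcoeff :: "int \<Rightarrow> laurent \<Rightarrow> symf" where
  "zcoeff m g = (\<Sum>j\<in>Poly_Mapping.keys g. h (m - j) * Poly_Mapping.lookup g j)"

lemma zcoeff_superset:
  assumes "finite A" "Poly_Mapping.keys g \<subseteq> A"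
  shows "zcoeff m g = (\<Sum>j\<in>A. h (m - j) * Poly_Mapping.lookup g j)"
  unfolding zcoeff_def using assms
  by (intro sum.mono_neutral_left) (auto simp: in_keys_iff)

lemma zcoeff_add: "zcoeff m (f + g) = zcoeff m f + zcoeff m g"
proof -
  let ?A = "Poly_Mapping.keys f \<union> Poly_Mapping.keys g"
  have "Poly_Mapping.keys (f + g) \<subseteq> ?A" by (rule Poly_Mapping.keys_add)
  then show ?thesis
    by (simp add: zcoeff_superset[of ?A] lookup_add distrib_left sum.distrib)
qed

lemma zcoeff_sum: "zcoeff m (sum F A) = (\<Sum>x\<in>A. zcoeff m (F x))"
  by (induction A rule: infinite_finite_induct) (simp_all add: zcoeff_add, simp_all add: zcoeff_def)

lemma zcoeff_lconst_times: "zcoeff m (lconst f * g) = f * zcoeff m g"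
proof -
  have "Poly_Mapping.keys (lconst f * g) \<subseteq> Poly_Mapping.keys g"
    by (auto simp: in_keys_iff lookup_lconst_times)
  then show ?thesis
    by (simp add: zcoeff_superset[of "Poly_Mapping.keys g"] lookup_lconst_times
      sum_distrib_left mult.left_commute)
qed

lemma zcoeff_zpow: "zcoeff m (zpow j) = h (m - j)"
  by (subst zcoeff_superset[of "{j}"]) (auto simp: zpow_def)

lemma zcoeff_zsym: "zcoeff m (zsym j) = hsym j m"
  by (simp add: zsym_def zcoeff_add zcoeff_zpow hsym_def)

lemma Y_eq_zcoeff: "Y (- m) f = zcoeff m (vertex_exp f)"
  by (simp add: Y_def Y_series_def zcoeff_def)

text \<open>The top row is a generating function for the row of a part yet to be put in
  front.\<close>

definition border_matrix :: "nat \<Rightarrow> (nat \<Rightarrow> int) \<Rightarrow> laurent mat" where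
  "border_matrix n b = mat (Suc n) (Suc n)
    (\<lambda>(i, j). if i = 0 then zsym (int j) else lconst (hsym (int j) (b (i - 1))))"

text \<open>Right multiplication by this matrix applies the three-term recurrence of
  \<open>z\<^sup>j + z\<^sup>-\<^sup>j\<close> to the columns, which clears the first row of a bordered matrix; the corner
  entry at (1, 1) accounts for the reflection of the column with index -1 into the one with index 1.\<close>

definition chebyshev_matrix :: "nat \<Rightarrow> laurent mat" where
  "chebyshev_matrix n = mat n n (\<lambda>(i, j). (if i = j then 1 else 0)
     - (if Suc i = j then zsym 1 else 0) + (if Suc (Suc i) = j then 1 else 0)
     + (if i = 1 \<and> j = 1 then 1 else 0))"

text \<open>The matrix is unitriangular except for the diagonal entry 2 at (1, 1), which exists from
  size 2 on.\<close>

lemma det_chebyshev_matrix: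
  assumes "n \<ge> 2"
  shows "det (chebyshev_matrix n) = 2"
proof -
  have "upper_triangular (chebyshev_matrix n)"
    by (auto simp: upper_triangular_def chebyshev_matrix_def)
  then have "det (chebyshev_matrix n) = prod_list (diag_mat (chebyshev_matrix n))"
    by (rule det_upper_triangular[where n = n]) (simp add: chebyshev_matrix_def)
  also have "\<dots> = (\<Prod>i\<in>{0..<n}. if i = 1 then 2 else 1)"
    unfolding prod_list_diag_prod
    by (rule prod.cong) (auto simp: chebyshev_matrix_def)
  finally show ?thesis using assms by (simp add: prod.delta)
qed

lemma mult_chebyshev_matrix:
  assumes "A \<in> carrier_mat m n" "i < m" "j < n"
  shows "(A * chebyshev_matrix n) $$ (i, j) =
    (if j = 0 then A $$ (i, 0)
     else if j = 1 then 2 * A $$ (i, 1) - zsym 1 * A $$ (i, 0)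
     else A $$ (i, j) - zsym 1 * A $$ (i, j - 1) + A $$ (i, j - 2))"
proof -
  have *: "(A * chebyshev_matrix n) $$ (i, j) =
    (\<Sum>k\<in>{0..<n}. A $$ (i, k) * ((if k = j then 1 else 0)
     - (if Suc k = j then zsym 1 else 0) + (if Suc (Suc k) = j then 1 else 0)
     + (if k = 1 \<and> j = 1 then 1 else 0)))"
    using assms by (auto simp: chebyshev_matrix_def scalar_prod_def intro!: sum.cong)
  consider "j = 0" | "j = 1" | l where "j = Suc (Suc l)"
    by (metis One_nat_def not0_implies_Suc)
  then show ?thesis
  proof cases
    case 1
    then show ?thesis using assms unfolding *
      by (simp add: if_distrib[of "times _"] cong: if_cong)
  next
    case 2
    then show ?thesis using assms unfolding *
      by (simp add: distrib_left right_diff_distrib sum.distrib sum_subtractf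
        if_distrib[of "times _"] mult.commute cong: if_cong)
  next
    case 3
    then show ?thesis using assms unfolding *
      by (simp add: distrib_left right_diff_distrib sum.distrib sum_subtractf
        if_distrib[of "times _"] mult.commute cong: if_cong)
  qed
qed

lemma det_border_matrix:
  assumes "n \<ge> 1"
  shows "det (border_matrix n b) =
    vertex_exp (det (mat n n (\<lambda>(i, j). hsym (int j) (b i + 1))))"
proof -
  let ?B = "border_matrix n b" and ?C = "chebyshev_matrix (Suc n)"
  let ?M = "mat n n (\<lambda>(i, j). hsym (int j) (b i + 1))"
  have B: "?B \<in> carrier_mat (Suc n) (Suc n)" and C: "?C \<in> carrier_mat (Suc n) (Suc n)"
    by (simp_all add: border_matrix_def chebyshev_matrix_def)
  then have BC: "?B * ?C \<in> carrier_mat (Suc n) (Suc n)" by simp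
  have zrec: "zsym (int j) - zsym 1 * zsym (int j - 1) + zsym (int j - 2) = 0" for j
    using zsym_mult[of "int j - 1" 1] by (simp add: mult.commute)
  \<comment> \<open>Column 1 is cleared because \<open>zsym 0\<close> is 2; the same 2 remains in
    the corner.\<close>
  have row0: "(?B * ?C) $$ (0, j) = (if j = 0 then 2 else 0)" if "j < Suc n" for j
    using that mult_chebyshev_matrix[OF B _ that, of 0] zrec[of j]
    by (auto simp: border_matrix_def zsym_0 of_nat_diff)
  have "mat_delete (?B * ?C) 0 0 = map_mat vertex_exp ?M"
  proof (rule eq_matI)
    fix i j assume ij: "i < dim_row (map_mat vertex_exp ?M)" "j < dim_col (map_mat vertex_exp ?M)"
    then have "mat_delete (?B * ?C) 0 0 $$ (i, j) = (?B * ?C) $$ (Suc i, Suc j)"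
      using B C by (simp add: mat_delete_def)
    also have "\<dots> = vertex_exp (?M $$ (i, j))"
      using ij mult_chebyshev_matrix[OF B, of "Suc i" "Suc j"] hsym_uminus[of 1 "b i"]
      by (cases j) (auto simp: border_matrix_def vertex_exp_hsym of_nat_diff add_ac)
    finally show "mat_delete (?B * ?C) 0 0 $$ (i, j) = map_mat vertex_exp ?M $$ (i, j)"
      using ij by simp
  qed (use B C in auto)
  then have "cofactor (?B * ?C) 0 0 = vertex_exp (det ?M)"
    by (simp add: cofactor_def)
  \<comment> \<open>The left 2 is the determinant of the column operations, the right one the
    surviving corner entry.\<close>
  moreover have "det ?B * 2 = 2 * cofactor (?B * ?C) 0 0"
  proof -
    have "det ?B * 2 = det (?B * ?C)"
      using det_mult[OF B C] det_chebyshev_matrix[of "Suc n"] assms by simp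
    also have "\<dots> = (\<Sum>j<Suc n. (?B * ?C) $$ (0, j) * cofactor (?B * ?C) 0 j)"
      by (rule laplace_expansion_row[OF BC]) simp
    also have "\<dots> = (\<Sum>j<Suc n. if j = 0 then 2 * cofactor (?B * ?C) 0 0 else 0)"
      by (rule sum.cong) (auto simp: row0)
    also have "\<dots> = 2 * cofactor (?B * ?C) 0 0"
      by (subst sum.delta) simp_all
    finally show ?thesis .
  qed
  ultimately show ?thesis by simp
qed

text \<open>Only the top row involves z, so expansion along it has constant cofactors, and
  \<open>zcoeff\<close> is linear over constants.\<close>

lemma zcoeff_det_border_matrix:
  "zcoeff m (det (border_matrix n b)) = det (mat (Suc n) (Suc n)
    (\<lambda>(i, j). hsym (int j) (if i = 0 then m else b (i - 1))))"
    (is "_ = det ?M")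
proof -
  let ?B = "border_matrix n b"
  have B: "?B \<in> carrier_mat (Suc n) (Suc n)" by (simp add: border_matrix_def)
  have cof: "cofactor ?B 0 j = lconst (cofactor ?M 0 j)" for j
  proof -
    have "mat_delete ?B 0 j = map_mat lconst (mat_delete ?M 0 j)"
      by (rule eq_matI) (auto simp: mat_delete_def border_matrix_def)
    then show ?thesis
      by (simp add: cofactor_def lconst.hom_mult lconst.hom_power lconst.hom_uminus)
  qed
  have "zcoeff m (det ?B) = (\<Sum>j<Suc n. zcoeff m (?B $$ (0, j) * cofactor ?B 0 j))"
    unfolding zcoeff_sum[symmetric] by (subst laplace_expansion_row[OF B, of 0]) simp_all
  also have "\<dots> = (\<Sum>j<Suc n. ?M $$ (0, j) * cofactor ?M 0 j)"
  proof (rule sum.cong)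
    fix j assume "j \<in> {..<Suc n}"
    then have "?B $$ (0, j) * cofactor ?B 0 j = lconst (cofactor ?M 0 j) * zsym (int j)"
      "?M $$ (0, j) = hsym (int j) m"
      unfolding cof by (simp_all add: border_matrix_def mult.commute)
    then show "zcoeff m (?B $$ (0, j) * cofactor ?B 0 j) = ?M $$ (0, j) * cofactor ?M 0 j"
      by (simp only: zcoeff_lconst_times zcoeff_zsym) (rule mult.commute)
  qed simp
  also have "\<dots> = det ?M"
    by (rule laplace_expansion_row[symmetric]) simp_all
  finally show ?thesis .
qed

section \<open>Putting a part in front of a partition\<close>

lemma Y_sp:
  assumes "mu \<noteq> []"
  shows "Y (- int l) (sp mu) = sp (l # mu)"
proof -
  \<comment> \<open>The new row pushes the rows of \<open>mu\<close> down by one, whence the extra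
    -1; \<open>det_border_matrix\<close> adds it back.\<close>
  let ?n = "length mu" and ?b = "\<lambda>i. int (mu ! i) - int i - 1"
  have "sp_matrix (l # mu) = mat (Suc ?n) (Suc ?n)
      (\<lambda>(i, j). hsym (int j) (if i = 0 then int l else ?b (i - 1)))"
    unfolding sp_matrix_eq by (rule eq_matI) (auto simp: nth_Cons split: nat.splits)
  moreover have "vertex_exp (det (sp_matrix mu)) = det (border_matrix ?n ?b)"
    using assms by (subst det_border_matrix) (simp_all add: sp_matrix_eq Suc_le_eq)
  ultimately show ?thesis
    by (simp add: Y_eq_zcoeff sp_def vertex_exp_cst_times zcoeff_lconst_times
      zcoeff_det_border_matrix)
qed

text \<open>The base case is one part: by the factor 1/2, \<open>sp []\<close> is 1/2 and not 1. For
  one part this factor cancels the doubled entry in column 0.\<close>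

lemma Y_1: "Y (- int l) 1 = sp [l]"
proof -
  have "det (sp_matrix [l]) = hsym 0 (int l)"
    by (simp add: sp_matrix_eq det_single)
  moreover have "cst (1 / 2) * (f + f) = f" for f
  proof -
    have "cst (1 / 2) * (f + f) = cst (1 / 2 + 1 / 2) * f"
      by (simp only: cst.hom_add distrib_left distrib_right)
    then show ?thesis by simp
  qed
  moreover have "zcoeff (int l) 1 = h (int l)"
    using zcoeff_zpow[of "int l" 0] by (simp add: zpow_def)
  ultimately show ?thesis
    by (simp add: Y_eq_zcoeff sp_def hsym_def)
qed

theorem theorem4p2:
  fixes lam :: "nat list"
  assumes "is_partition lam" and "length lam \<ge> 1"
  shows "foldr (\<lambda>l. Y (- int l)) lam 1 = sp lam \<and>
    sp lam = cst (1 / 2) *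
      det (mat (length lam) (length lam) (\<lambda>(a, b).
        let i = int a + 1; j = int b + 1; l = int (lam ! a)
        in h (l - i + j) + h (l - i - j + 2)))"
proof
  have "lam \<noteq> []" using assms by auto
  \<comment> \<open>The last part acts first, so the list grows at its head from a single
    element.\<close>
  then show "foldr (\<lambda>l. Y (- int l)) lam 1 = sp lam"
    by (induction lam rule: list_nonempty_induct) (simp_all add: Y_1 Y_sp)
qed (simp add: sp_def sp_matrix_def)

end
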